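(* Let $S=\{i_1<i_2<\cdots<i_s\}$ be a nonempty admissible set, and let $S_1=S\setminus\{i_s\}$ and $S_2=S_1\cup\{i_s-1\}$. Then \[\#\widehat{P}_B(S,n)=\binom{n}{i_s-1}\,\#\widehat{P}_B(S_1,i_s-1)\,2^{2(n-i_s)+1}-\#\widehat{P}_B(S_1,n)-\#\widehat{P}_B(S_2,n).\]
   Context: For $n\ge1$ (and $B_0$ consisting of the empty word), $B_n$ is the set of signed permutations $\pi=\pi_1\cdots\pi_n$: words with each $\pi_i\in\{-n,\dots,-1,1,\dots,n\}$ and $\{|\pi_1|,\dots,|\pi_n|\}=\{1,\dots,n\}$. Set $\pi_0=0$. An index $i\in\{1,\dots,n-1\}$ is a peak of $\pi$ if $\pi_{i-1}<\pi_i>\pi_{i+1}$ (so $1$ is a peak iff $0<\pi_1>\pi_2$). $\widehat{P}_B(S,n)$ is the set of $\pi\in B_n$ whose peak set (in this sense) equals $S$. $S$ is $n$-admissible if $\widehat{P}_B(S,n)\neq\emptyset$, and admissible if $n$-admissible for some $n$; the identity is asserted for every $n$ for which $S$ is $n$-admissible. *)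

theory Defs
  imports Complex_Main
begin

text \<open>
  Signed permutations of \<open>{1..n}\<close> as words (lists of integers). For \<open>n = 0\<close> the only one is the
  empty word.
\<close>

definition signed_perms :: "nat \<Rightarrow> int list set" where
  "signed_perms n = {\<pi>. length \<pi> = n \<and> set \<pi> \<subseteq> {- int n..-1} \<union> {1..int n}
                          \<and> abs ` set \<pi> = {1..int n}}"

text \<open>Letters are indexed from 1, with the convention that the letter at index 0 is 0.\<close>

definition letter :: "int list \<Rightarrow> nat \<Rightarrow> int" where
  "letter \<pi> i = (0 # \<pi>) ! i"

definition peak_set :: "int list \<Rightarrow> nat set" where
  "peak_set \<pi> = {i \<in> {1..<length \<pi>}. letter \<pi> (i - 1) < letter \<pi> i \<and> letter \<pi> i > letter \<pi> (i + 1)}"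

definition signed_perms_with_peaks :: "nat set \<Rightarrow> nat \<Rightarrow> int list set" where
  "signed_perms_with_peaks S n = {\<pi> \<in> signed_perms n. peak_set \<pi> = S}"

definition n_admissible :: "nat \<Rightarrow> nat set \<Rightarrow> bool" where
  "n_admissible n S \<longleftrightarrow> signed_perms_with_peaks S n \<noteq> {}"

definition admissible :: "nat set \<Rightarrow> bool" where
  "admissible S \<longleftrightarrow> (\<exists>n. n_admissible n S)"

lemma finite_signed_perms: "finite (signed_perms n)"
  by (rule finite_subset[OF _ finite_lists_length_eq[of "{- int n..-1} \<union> {1..int n}" n]])
     (auto simp: signed_perms_def)

end

theory Submission
  imports Defs
begin

text \<open>
  With \<open>k = m - 1\<close>, count in two ways the signed permutations whose first \<open>k\<close> letters have peak
  set \<open>S1\<close> and whose last \<open>n - k\<close> letters contain no peak in their interior. Only \<open>k\<close> and \<open>k + 1\<close>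
  can be further peaks of such a word, and not both, so its peak set is \<open>S1\<close>, \<open>S2\<close> or \<open>S\<close>. On the
  other hand one chooses the \<open>k\<close> absolute values of the prefix, a prefix pattern, the signs of the
  \<open>r = n - k\<close> remaining letters, and one of their \<open>2 ^ (r - 1)\<close> arrangements without interior peak:
  the largest letter must stand at one of the two ends, and removing it leaves such an arrangement.
\<close>

section \<open>Signed words over a set of absolute values\<close>

text \<open>The set \<open>A\<close> is arbitrary so that both pieces of a signed permutation cut in
  two are again of this kind.\<close>

definition signed_words :: "int set \<Rightarrow> int list set" where
  "signed_words A = {\<pi>. distinct (map abs \<pi>) \<and> abs ` set \<pi> = A}"

text \<open>In contrast to \<open>peak_set\<close>, no letter 0 is put in front: the word serves as
  the tail of a longer one, and only letters with two neighbours inside it are tested.\<close>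

definition no_inner_peak :: "int list \<Rightarrow> bool" where
  "no_inner_peak v \<longleftrightarrow> (\<forall>i. Suc (Suc i) < length v \<longrightarrow> \<not> (v ! i < v ! Suc i \<and> v ! Suc (Suc i) < v ! Suc i))"

text \<open>A word of \<open>n\<close> letters that realises \<open>n\<close> absolute values cannot
  repeat one, so fixing the length amounts to requiring distinctness.\<close>

lemma signed_perms_eq: "signed_perms n = signed_words {1..int n}"
proof -
  have "\<pi> \<in> signed_perms n \<longleftrightarrow> \<pi> \<in> signed_words {1..int n}" for \<pi>
  proof
    assume "\<pi> \<in> signed_perms n"
    hence "length (map abs \<pi>) = n" "set (map abs \<pi>) = {1..int n}" by (auto simp: signed_perms_def)
    thus "\<pi> \<in> signed_words {1..int n}"
      by (auto simp: signed_words_def intro!: card_distinct)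
  next
    assume a: "\<pi> \<in> signed_words {1..int n}"
    hence d: "distinct (map abs \<pi>)" and s: "abs ` set \<pi> = {1..int n}" by (auto simp: signed_words_def)
    have "length \<pi> = n" using distinct_card[OF d] s by simp
    moreover have "set \<pi> \<subseteq> {- int n..-1} \<union> {1..int n}"
    proof
      fix x assume "x \<in> set \<pi>"
      hence "\<bar>x\<bar> \<in> {1..int n}" using s by blast
      thus "x \<in> {- int n..-1} \<union> {1..int n}" by auto
    qed
    ultimately show "\<pi> \<in> signed_perms n" using s by (simp add: signed_perms_def)
  qed
  thus ?thesis by blast
qed

lemma length_signed_words: "\<pi> \<in> signed_words A \<Longrightarrow> length \<pi> = card A"
  using distinct_card[of "map abs \<pi>"] by (auto simp: signed_words_def)

lemma finite_signed_words:
  assumes "finite A"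
  shows "finite (signed_words A)"
proof (rule finite_subset[OF _ finite_lists_length_eq])
  show "signed_words A \<subseteq> {\<pi>. set \<pi> \<subseteq> A \<union> uminus ` A \<and> length \<pi> = card A}"
  proof
    fix \<pi> assume a: "\<pi> \<in> signed_words A"
    have "x \<in> A \<union> uminus ` A" if "x \<in> set \<pi>" for x
    proof -
      have "\<bar>x\<bar> \<in> A" using that a by (auto simp: signed_words_def)
      thus ?thesis by (cases "x \<ge> 0") (auto simp: image_iff intro: bexI[of _ "-x"])
    qed
    thus "\<pi> \<in> {\<pi>. set \<pi> \<subseteq> A \<union> uminus ` A \<and> length \<pi> = card A}"
      using length_signed_words[OF a] by auto
  qed
  show "finite (A \<union> uminus ` A)" using assms by simp
qed

lemma append_signed_words_iff:
  "u @ v \<in> signed_words A \<longleftrightarrow>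
     abs ` set u \<subseteq> A \<and> u \<in> signed_words (abs ` set u) \<and> v \<in> signed_words (A - abs ` set u)"
  by (auto simp: signed_words_def)

section \<open>Relabelling the absolute values\<close>

text \<open>Induction on the largest element: it goes to \<open>Max B\<close>, and the map given by
  the induction hypothesis sends everything else strictly below it.\<close>

lemma ex_strict_mono_bij:
  fixes A B :: "'a::linorder set"
  assumes "finite A" "finite B" "card A = card B"
  shows "\<exists>g. strict_mono_on A g \<and> g ` A = B"
  using assms
proof (induction A arbitrary: B rule: finite_linorder_max_induct)
  case empty
  thus ?case by (auto simp: strict_mono_on_def)
next
  case (insert M A)
  have M: "M \<notin> A" using insert.hyps(2) by auto
  have B: "B \<noteq> {}" using insert.prems M insert.hyps(1) by auto
  define N where "N = Max B"
  have NB: "N \<in> B" using B insert.prems(1) by (simp add: N_def)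
  have N: "b \<le> N" if "b \<in> B" for b using insert.prems(1) that by (simp add: N_def)
  have "card A = card (B - {N})" using insert M NB by simp
  then obtain g where g: "strict_mono_on A g" "g ` A = B - {N}"
    using insert.IH[of "B - {N}"] insert.prems(1) by auto
  have lt: "g a < N" if "a \<in> A" for a using g(2) that N[of "g a"] by force
  have "strict_mono_on (insert M A) (g(M := N))"
  proof (rule strict_mono_onI)
    fix x y assume xy: "x \<in> insert M A" "y \<in> insert M A" "x < y"
    have "x \<noteq> M" using xy insert.hyps(2) by (metis insertE less_asym less_irrefl)
    thus "(g(M := N)) x < (g(M := N)) y"
      using xy lt strict_mono_onD[OF g(1), of x y] by auto
  qed
  moreover have "(g(M := N)) ` insert M A = B" using g(2) M NB by (auto simp: image_iff)
  ultimately show ?case by blast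
qed

text \<open>Peaks depend only on comparisons of letters. The letter 0 in front takes part in them,
  hence the conditions on 0.\<close>

lemma peak_set_map:
  assumes "strict_mono_on D f" "f 0 = 0" "0 \<in> D" "set \<pi> \<subseteq> D"
  shows "peak_set (map f \<pi>) = peak_set \<pi>"
proof -
  have l: "letter (map f \<pi>) i = f (letter \<pi> i)" "letter \<pi> i \<in> D" if "i \<le> length \<pi>" for i
    using that assms(2-4) by (cases i; force simp: letter_def)+
  have f: "f x < f y \<longleftrightarrow> x < y" if "x \<in> D" "y \<in> D" for x y
    using strict_mono_on_less[OF assms(1)] that by blast
  show ?thesis unfolding peak_set_def using l f by auto
qed

text \<open>Relabelling the absolute values in increasing order while keeping the signs is injective
  and preserves the order of the signed letters, hence the peaks.\<close>

lemma card_signed_words_peaks_le: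
  assumes "finite A" "finite B" "card A = card B" "A \<subseteq> {1..}" "B \<subseteq> {1..}"
  shows "card {\<pi> \<in> signed_words A. peak_set \<pi> = T} \<le> card {\<pi> \<in> signed_words B. peak_set \<pi> = T}"
proof -
  obtain g where g: "strict_mono_on A g" "g ` A = B" using ex_strict_mono_bij assms(1-3) by blast
  \<comment> \<open>The odd extension of \<open>g\<close>; since \<open>sgn 0 = 0\<close>, it fixes
    0 whatever \<open>g 0\<close> is.\<close>
  define f where "f x = sgn x * g \<bar>x\<bar>" for x
  define D where "D = {x. \<bar>x\<bar> \<in> A} \<union> {0}"
  have gpos: "g a > 0" if "a \<in> A" for a using that g(2) assms(5) by (force simp: subset_iff)
  have mono: "strict_mono_on D f"
  proof (rule strict_mono_onI)
    fix x y assume xy: "x \<in> D" "y \<in> D" "x < y"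
    have gm: "g a < g b" if "a \<in> A" "b \<in> A" "a < b" for a b
      using strict_mono_onD[OF g(1)] that by blast
    consider "x < 0" "y < 0" | "x < 0" "y = 0" | "x < 0" "y > 0" | "x = 0" "y > 0" | "x > 0" "y > 0"
      using xy(3) by linarith
    thus "f x < f y"
    proof cases
      case 1
      thus ?thesis using xy gm[of "-y" "-x"] by (auto simp: f_def D_def)
    next
      case 2
      thus ?thesis using xy gpos[of "-x"] by (auto simp: f_def D_def)
    next
      case 3
      thus ?thesis using xy gpos[of "-x"] gpos[of y] by (auto simp: f_def D_def)
    next
      case 4
      thus ?thesis using xy gpos[of y] by (auto simp: f_def D_def)
    next
      case 5
      thus ?thesis using xy gm[of x y] by (auto simp: f_def D_def)
    qed
  qed
  have sub: "set \<pi> \<subseteq> D" if "\<pi> \<in> signed_words A" for \<pi>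
    using that by (auto simp: signed_words_def D_def)
  have absf: "\<bar>f x\<bar> = g \<bar>x\<bar>" if "\<bar>x\<bar> \<in> A" for x
  proof -
    have "x \<noteq> 0" using that assms(4) by auto
    thus ?thesis using gpos[OF that] by (simp add: f_def abs_mult abs_sgn_eq)
  qed
  have im: "map f \<pi> \<in> signed_words B" if a: "\<pi> \<in> signed_words A" for \<pi>
  proof -
    have d: "distinct (map abs \<pi>)" and s: "abs ` set \<pi> = A" using a by (auto simp: signed_words_def)
    have e: "map abs (map f \<pi>) = map g (map abs \<pi>)" using s absf by auto
    have "distinct (map abs (map f \<pi>))"
      unfolding e distinct_map[of g] using d s strict_mono_on_imp_inj_on[OF g(1)] by simp
    moreover have "set (map abs (map f \<pi>)) = B" unfolding e by (simp add: s g(2) flip: image_image)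
    ultimately show ?thesis by (simp add: signed_words_def image_image)
  qed
  show ?thesis
  proof (rule card_inj_on_le[where f = "map f"])
    show "inj_on (map f) {\<pi> \<in> signed_words A. peak_set \<pi> = T}"
      using sub by (intro inj_on_mapI inj_on_subset[OF strict_mono_on_imp_inj_on[OF mono]]) auto
    show "map f ` {\<pi> \<in> signed_words A. peak_set \<pi> = T} \<subseteq> {\<pi> \<in> signed_words B. peak_set \<pi> = T}"
      using im sub peak_set_map[OF mono] by (auto simp: f_def D_def)
    show "finite {\<pi> \<in> signed_words B. peak_set \<pi> = T}" using finite_signed_words assms(2) by simp
  qed
qed

text \<open>The inequality is used in both directions between \<open>A\<close> and
  \<open>{1..int (card A)}\<close>.\<close>

lemma card_signed_words_peaks:
  assumes "finite A" "A \<subseteq> {1..}"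
  shows "card {\<pi> \<in> signed_words A. peak_set \<pi> = T} = card (signed_perms_with_peaks T (card A))"
  unfolding signed_perms_with_peaks_def signed_perms_eq
  by (rule antisym; rule card_signed_words_peaks_le) (use assms in auto)

section \<open>Arrangements without inner peak\<close>

text \<open>The only new triple starts with a descent from \<open>M\<close>, so its middle letter is
  no peak.\<close>

lemma no_inner_peak_Cons:
  assumes "\<And>x. x \<in> set v \<Longrightarrow> x < M"
  shows "no_inner_peak (M # v) \<longleftrightarrow> no_inner_peak v"
proof
  assume a: "no_inner_peak (M # v)"
  show "no_inner_peak v" unfolding no_inner_peak_def
  proof (intro allI impI)
    fix i assume "Suc (Suc i) < length v"
    thus "\<not> (v ! i < v ! Suc i \<and> v ! Suc (Suc i) < v ! Suc i)"
      using a[unfolded no_inner_peak_def, rule_format, of "Suc i"] by simp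
  qed
next
  assume a: "no_inner_peak v"
  show "no_inner_peak (M # v)" unfolding no_inner_peak_def
  proof (intro allI impI)
    fix i assume i: "Suc (Suc i) < length (M # v)"
    show "\<not> ((M # v) ! i < (M # v) ! Suc i \<and> (M # v) ! Suc (Suc i) < (M # v) ! Suc i)"
    proof (cases i)
      case 0
      have "v ! 0 < M" using i 0 by (intro assms nth_mem) auto
      thus ?thesis using 0 by simp
    next
      case (Suc j)
      thus ?thesis using i a by (simp add: no_inner_peak_def)
    qed
  qed
qed

lemma no_inner_peak_rev: "no_inner_peak (rev v) \<longleftrightarrow> no_inner_peak v"
proof -
  have "no_inner_peak (rev v)" if a: "no_inner_peak v" for v
    unfolding no_inner_peak_def
  proof (intro allI impI)
    fix i assume i: "Suc (Suc i) < length (rev v)"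
    \<comment> \<open>Positions \<open>i\<close>, \<open>i + 1\<close>, \<open>i + 2\<close> of the
      reversed word are positions \<open>j + 2\<close>, \<open>j + 1\<close>, \<open>j\<close> of
      \<open>v\<close>.\<close>
    define j where "j = length v - Suc (Suc (Suc i))"
    have "rev v ! i = v ! Suc (Suc j)" "rev v ! Suc i = v ! Suc j" "rev v ! Suc (Suc i) = v ! j"
      using i by (simp_all add: rev_nth j_def Suc_diff_Suc)
    moreover have "Suc (Suc j) < length v" using i by (simp add: j_def)
    ultimately show "\<not> (rev v ! i < rev v ! Suc i \<and> rev v ! Suc (Suc i) < rev v ! Suc i)"
      using a by (auto simp: no_inner_peak_def)
  qed
  from this[of v] this[of "rev v"] show ?thesis by auto
qed

lemma no_inner_peak_snoc:
  assumes "\<And>x. x \<in> set v \<Longrightarrow> x < M"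
  shows "no_inner_peak (v @ [M]) \<longleftrightarrow> no_inner_peak v"
  using no_inner_peak_Cons[of "rev v" M] assms no_inner_peak_rev[of "v @ [M]"] no_inner_peak_rev[of v]
  by simp

text \<open>With letters on both sides, \<open>M\<close> would exceed both its neighbours.\<close>

lemma no_inner_peak_max_at_end:
  assumes "no_inner_peak (u @ M # v)" "\<And>x. x \<in> set u \<union> set v \<Longrightarrow> x < M"
  shows "u = [] \<or> v = []"
proof (rule ccontr)
  assume "\<not> ?thesis"
  then obtain u' a b v' where "u = u' @ [a]" "v = b # v'" by (metis rev_exhaust list.exhaust)
  thus False using assms(1)[unfolded no_inner_peak_def, rule_format, of "length u'"] assms(2)
    by (auto simp: nth_append)
qed

text \<open>Adding a new largest letter at either end doubles the count, which is 1 for a single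
  letter.\<close>

lemma card_no_inner_peak_arrangements:
  assumes "finite C" "C \<noteq> {}"
  shows "card {v. distinct v \<and> set v = C \<and> no_inner_peak v} = 2 ^ (card C - 1)"
  using assms
proof (induction rule: finite_linorder_max_induct)
  case empty
  thus ?case by simp
next
  case (insert M C)
  show ?case
  proof (cases "C = {}")
    \<comment> \<open>The induction really starts here, as the induction hypothesis speaks of
      nonempty sets only.\<close>
    case True
    have "{v. distinct v \<and> set v = {M} \<and> no_inner_peak v} = {[M]}"
    proof -
      have "v = [M]" if "distinct v" "set v = {M}" for v
        using that by (cases v; cases "tl v") auto
      thus ?thesis by (auto simp: no_inner_peak_def)
    qed
    thus ?thesis using True by simp
  next
    case False
    define V where "V = {v. distinct v \<and> set v = C \<and> no_inner_peak v}"
    have finV: "finite V"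
      by (rule finite_subset[OF _ finite_subset_distinct[OF insert.hyps(1)]]) (auto simp: V_def)
    have M: "M \<notin> C" using insert.hyps(2) by auto
    have "{v. distinct v \<and> set v = insert M C \<and> no_inner_peak v} = (\<lambda>v. M # v) ` V \<union> (\<lambda>v. v @ [M]) ` V"
    proof (intro equalityI subsetI)
      fix w assume "w \<in> {v. distinct v \<and> set v = insert M C \<and> no_inner_peak v}"
      hence w: "distinct w" "set w = insert M C" "no_inner_peak w" by auto
      obtain u v where uv: "w = u @ M # v" using w(2) by (metis insertI1 split_list)
      have uvC: "set u \<union> set v = C" using w uv M by auto
      hence lt: "x < M" if "x \<in> set u \<union> set v" for x using that insert.hyps(2) by blast
      have "u = [] \<or> v = []" using no_inner_peak_max_at_end w(3) uv lt by blast
      thus "w \<in> (\<lambda>v. M # v) ` V \<union> (\<lambda>v. v @ [M]) ` V"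
      proof
        assume "u = []"
        thus ?thesis using w uv uvC lt no_inner_peak_Cons[of v M] by (auto simp: V_def)
      next
        assume "v = []"
        thus ?thesis using w uv uvC lt no_inner_peak_snoc[of u M] by (auto simp: V_def)
      qed
    next
      fix w assume "w \<in> (\<lambda>v. M # v) ` V \<union> (\<lambda>v. v @ [M]) ` V"
      thus "w \<in> {v. distinct v \<and> set v = insert M C \<and> no_inner_peak v}"
        using M insert.hyps(2) no_inner_peak_Cons no_inner_peak_snoc by (auto simp: V_def)
    qed
    moreover have "(\<lambda>v. M # v) ` V \<inter> (\<lambda>v. v @ [M]) ` V = {}"
    proof -
      \<comment> \<open>Equality would put \<open>M\<close> at the head of \<open>v'\<close>, or
        make \<open>v'\<close> empty; \<open>M \<notin> C\<close> and \<open>C \<noteq> {}\<close>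
        exclude both.\<close>
      have "M # v \<noteq> v' @ [M]" if "v \<in> V" "v' \<in> V" for v v'
        using that M False by (cases v') (auto simp: V_def)
      thus ?thesis by blast
    qed
    ultimately have "card {v. distinct v \<and> set v = insert M C \<and> no_inner_peak v} = card V + card V"
      using finV by (simp add: card_Un_disjoint card_image inj_on_def)
    moreover have "card V = 2 ^ (card C - 1)" using insert.IH False V_def by simp
    moreover have "card C > 0" using False insert.hyps(1) by (simp add: card_gt_0_iff)
    ultimately show ?thesis using insert.hyps(1) M by (cases "card C") auto
  qed
qed

text \<open>There are \<open>2 ^ card A\<close> choices of signs. Each fixes a set of
  \<open>card A\<close> letters, to which the previous count applies.\<close>

lemma card_signed_words_no_inner_peak:
  assumes "finite A" "A \<noteq> {}" "A \<subseteq> {1..}"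
  shows "card {v \<in> signed_words A. no_inner_peak v} = 2 ^ (2 * card A - 1)"
proof -
  \<comment> \<open>A choice of signs is encoded by the set \<open>P\<close> of absolute values that
    keep a positive sign.\<close>
  define sg where "sg P = P \<union> uminus ` (A - P)" for P
  define F where "F P = {v. distinct v \<and> set v = sg P \<and> no_inner_peak v}" for P
  have pos: "x > 0" if "x \<in> A" for x using that assms(3) by (force simp: subset_iff)
  have sgP: "{x \<in> sg P. x > 0} = P" if "P \<subseteq> A" for P
    using that pos by (force simp: sg_def)
  have abs_sg: "abs ` sg P = A" "inj_on abs (sg P)" if "P \<subseteq> A" for P
  proof -
    have "abs ` P = P" "abs ` (uminus ` (A - P)) = A - P"
      using that pos by (force simp: image_iff)+
    thus "abs ` sg P = A" using that by (auto simp: sg_def image_Un)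
    show "inj_on abs (sg P)" using that pos by (fastforce simp: sg_def inj_on_def abs_if)
  qed
  have U: "{v \<in> signed_words A. no_inner_peak v} = (\<Union>P\<in>Pow A. F P)"
  proof (intro equalityI subsetI)
    fix v assume "v \<in> {v \<in> signed_words A. no_inner_peak v}"
    hence v: "distinct v" "inj_on abs (set v)" "abs ` set v = A" "no_inner_peak v"
      by (auto simp: signed_words_def distinct_map)
    define P where "P = {x \<in> set v. x > 0}"
    have "P \<subseteq> A" using v(3) by (force simp: P_def)
    have "x \<in> set v \<longleftrightarrow> x \<in> sg P" for x
    proof
      assume x: "x \<in> set v"
      hence xA: "\<bar>x\<bar> \<in> A" using v(3) by blast
      show "x \<in> sg P"
      proof (cases "x > 0")
        case False
        \<comment> \<open>A letter and its negative cannot both occur, because the absolute values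
          are distinct.\<close>
        hence "- x \<notin> P" using x inj_onD[OF v(2), of x "- x"] by (auto simp: P_def)
        hence "- x \<in> A - P" using xA False by simp
        thus ?thesis unfolding sg_def by (metis UnI2 image_eqI minus_minus)
      qed (use x in \<open>simp add: sg_def P_def\<close>)
    next
      assume x: "x \<in> sg P"
      show "x \<in> set v"
      proof (cases "x \<in> P")
        case False
        then obtain y where y: "y \<in> A" "y \<notin> P" "x = - y" using x by (auto simp: sg_def)
        then obtain z where z: "z \<in> set v" "y = \<bar>z\<bar>" using v(3) by blast
        \<comment> \<open>The letter with absolute value \<open>y\<close> cannot be positive, as
          \<open>y\<close> would then lie in \<open>P\<close>; so it is \<open>- y\<close>.\<close>
        have "z \<notin> P" if "z > 0" using that z y(2) by simp
        hence "z \<le> 0" using z(1) by (force simp: P_def)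
        thus ?thesis using z y by simp
      qed (simp add: P_def)
    qed
    hence "v \<in> F P" using v by (auto simp: F_def)
    thus "v \<in> (\<Union>P\<in>Pow A. F P)" using \<open>P \<subseteq> A\<close> by blast
  next
    fix v assume "v \<in> (\<Union>P\<in>Pow A. F P)"
    then obtain P where "P \<subseteq> A" "v \<in> F P" by blast
    thus "v \<in> {v \<in> signed_words A. no_inner_peak v}"
      using abs_sg[of P] by (simp add: F_def signed_words_def distinct_map)
  qed
  have finsg: "finite (sg P)" if "P \<subseteq> A" for P
    using that assms(1) by (simp add: sg_def finite_subset)
  have cardsg: "card (sg P) = card A" if "P \<subseteq> A" for P
    using card_image[OF abs_sg(2)[OF that]] abs_sg(1)[OF that] by simp
  have cF: "card (F P) = 2 ^ (card A - 1)" if "P \<subseteq> A" for P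
  proof -
    have "sg P \<noteq> {}" using abs_sg(1)[OF that] assms(2) by auto
    thus ?thesis unfolding F_def
      using card_no_inner_peak_arrangements[OF finsg[OF that]] cardsg[OF that] by simp
  qed
  have "card (\<Union>P\<in>Pow A. F P) = (\<Sum>P\<in>Pow A. card (F P))"
  proof (rule card_UN_disjoint)
    show "finite (Pow A)" using assms(1) by simp
    \<comment> \<open>An infinite set has cardinality 0, whereas \<open>cF\<close> gives a power of
      2.\<close>
    show "\<forall>P\<in>Pow A. finite (F P)"
      by (intro ballI card_ge_0_finite) (simp add: cF)
    show "\<forall>P\<in>Pow A. \<forall>Q\<in>Pow A. P \<noteq> Q \<longrightarrow> F P \<inter> F Q = {}"
    proof (intro ballI impI)
      fix P Q assume "P \<in> Pow A" "Q \<in> Pow A" "P \<noteq> Q"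
      \<comment> \<open>\<open>P\<close> is recovered from \<open>sg P\<close> as its positive
        part.\<close>
      hence "sg P \<noteq> sg Q" by (metis sgP PowD)
      thus "F P \<inter> F Q = {}" by (auto simp: F_def)
    qed
  qed
  also have "\<dots> = 2 ^ card A * 2 ^ (card A - 1)"
    using cF assms(1) by (simp add: card_Pow)
  also have "\<dots> = 2 ^ (2 * card A - 1)"
  proof -
    have "card A > 0" using assms(1,2) by (simp add: card_gt_0_iff)
    thus ?thesis by (simp add: power_add[symmetric] mult_2)
  qed
  finally show ?thesis using U by simp
qed

section \<open>Cutting a word into prefix and suffix\<close>

text \<open>Whether \<open>i\<close> is a peak depends on the letters up to index
  \<open>i + 1\<close>, and these lie in \<open>u\<close> when \<open>i < length u\<close>.\<close>

lemma peak_set_append_left: "peak_set (u @ v) \<inter> {..<length u} = peak_set u"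
proof -
  have "letter (u @ v) i = letter u i" if "i \<le> length u" for i
    using that by (cases i) (auto simp: letter_def nth_append)
  thus ?thesis by (auto simp: peak_set_def)
qed

text \<open>The bound \<open>length u + 2\<close> is the first index whose left neighbour already
  belongs to \<open>v\<close>.\<close>

lemma peak_set_append_right:
  "peak_set (u @ v) \<inter> {length u + 2..} = {} \<longleftrightarrow> no_inner_peak v"
proof -
  have l: "letter (u @ v) (Suc (length u + j)) = v ! j" for j
    by (simp add: letter_def nth_append)
  \<comment> \<open>\<open>letter\<close> counts from 1 and \<open>!\<close> from 0: index
    \<open>length u + 2 + j\<close> of the whole word is position \<open>Suc j\<close> of
    \<open>v\<close>.\<close>
  have p: "length u + 2 + j \<in> peak_set (u @ v) \<longleftrightarrow>
      Suc (Suc j) < length v \<and> v ! j < v ! Suc j \<and> v ! Suc (Suc j) < v ! Suc j" for j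
    using l[of j] l[of "Suc j"] l[of "Suc (Suc j)"] by (auto simp: peak_set_def)
  have "peak_set (u @ v) \<inter> {length u + 2..} = {} \<longleftrightarrow> (\<forall>j. length u + 2 + j \<notin> peak_set (u @ v))"
    by (auto simp: le_iff_add)
  thus ?thesis unfolding p no_inner_peak_def by blast
qed

text \<open>Cut after \<open>k\<close> letters: the first condition concerns the prefix alone and
  the second the suffix alone, while the indices \<open>k\<close> and \<open>k + 1\<close> at the
  cut stay free.\<close>

lemma card_peaks_below_above:
  assumes "k < n"
  shows "card {\<pi> \<in> signed_perms n. peak_set \<pi> \<inter> {..<k} = T \<and> peak_set \<pi> \<inter> {k + 2..} = {}}
       = (n choose k) * card (signed_perms_with_peaks T k) * 2 ^ (2 * (n - k) - 1)"
    (is "card ?X = _")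
proof -
  define N where "N = {1..int n}"
  define \<B> where "\<B> = {B. B \<subseteq> N \<and> card B = k}"
  define L where "L B = {u \<in> signed_words B. peak_set u = T}" for B
  define R where "R B = {v \<in> signed_words (N - B). no_inner_peak v}" for B
  have finN: "finite N" and cN: "card N = n" by (auto simp: N_def)
  have "bij_betw (\<lambda>(B, u, v). u @ v) (SIGMA B:\<B>. L B \<times> R B) ?X"
  proof (rule bij_betw_imageI)
    show "inj_on (\<lambda>(B, u, v). u @ v) (SIGMA B:\<B>. L B \<times> R B)"
    proof -
      \<comment> \<open>All prefixes have length \<open>k\<close>, so the word determines the cut,
        and the prefix determines \<open>B\<close>.\<close>
      have eq: "B = B' \<and> u = u' \<and> v = v'"
        if B: "B \<in> \<B>" "B' \<in> \<B>" and u: "u \<in> L B" "u' \<in> L B'" and e: "u @ v = u' @ v'"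
        for B u v B' u' v'
      proof -
        have "length u = k" "length u' = k"
          using B u length_signed_words[of u B] length_signed_words[of u' B'] by (auto simp: L_def \<B>_def)
        hence "u = u'" "v = v'" using e by auto
        moreover have "abs ` set u = B" "abs ` set u' = B'" using u by (auto simp: L_def signed_words_def)
        ultimately show ?thesis by simp
      qed
      show ?thesis
      proof (rule inj_onI)
        fix p q
        assume pq: "p \<in> (SIGMA B:\<B>. L B \<times> R B)" "q \<in> (SIGMA B:\<B>. L B \<times> R B)"
          "(\<lambda>(B, u, v). u @ v) p = (\<lambda>(B, u, v). u @ v) q"
        obtain B u v where p: "p = (B, u, v)" by (cases p)
        obtain B' u' v' where q: "q = (B', u', v')" by (cases q)
        show "p = q" using eq[of B B' u u' v v'] pq unfolding p q by simp
      qed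
    qed
    show "(\<lambda>(B, u, v). u @ v) ` (SIGMA B:\<B>. L B \<times> R B) = ?X"
    proof (intro equalityI subsetI)
      fix w assume "w \<in> (\<lambda>(B, u, v). u @ v) ` (SIGMA B:\<B>. L B \<times> R B)"
      then obtain B u v where w: "w = u @ v" and B: "B \<in> \<B>" and u: "u \<in> L B" and v: "v \<in> R B"
        by auto
      have len: "length u = k" and absu: "abs ` set u = B"
        using u B length_signed_words[of u B] by (auto simp: L_def \<B>_def signed_words_def)
      have "w \<in> signed_words N"
        unfolding w append_signed_words_iff using u v B absu by (auto simp: L_def R_def \<B>_def)
      moreover have "peak_set w \<inter> {..<k} = T"
        using peak_set_append_left[of u v] len u w by (simp add: L_def)
      moreover have "peak_set w \<inter> {k + 2..} = {}"
        using peak_set_append_right[of u v] len v w by (simp add: R_def)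
      ultimately show "w \<in> ?X" by (simp add: signed_perms_eq N_def)
    next
      fix w assume w: "w \<in> ?X"
      define u where "u = take k w"
      define v where "v = drop k w"
      define B where "B = abs ` set u"
      have wuv: "w = u @ v" by (simp add: u_def v_def)
      have wN: "u @ v \<in> signed_words N" using w unfolding wuv by (simp add: signed_perms_eq N_def)
      have len: "length u = k" using length_signed_words[OF wN[folded wuv]] assms cN by (simp add: u_def)
      have s: "B \<subseteq> N" "u \<in> signed_words B" "v \<in> signed_words (N - B)"
        using wN unfolding append_signed_words_iff B_def by blast+
      have "B \<in> \<B>" using s length_signed_words[OF s(2)] len by (simp add: \<B>_def)
      moreover have "u \<in> L B" using s w peak_set_append_left[of u v] unfolding len wuv[symmetric] by (simp add: L_def)
      moreover have "v \<in> R B" using s w peak_set_append_right[of u v] unfolding len wuv[symmetric] by (simp add: R_def)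
      ultimately show "w \<in> (\<lambda>(B, u, v). u @ v) ` (SIGMA B:\<B>. L B \<times> R B)"
        using wuv by force
    qed
  qed
  hence "card ?X = card (SIGMA B:\<B>. L B \<times> R B)" by (simp add: bij_betw_same_card)
  also have "\<dots> = (\<Sum>B\<in>\<B>. card (L B \<times> R B))"
  proof (rule card_SigmaI)
    show "finite \<B>" using finN by (simp add: \<B>_def)
    show "\<forall>B\<in>\<B>. finite (L B \<times> R B)"
      using finN by (auto simp: \<B>_def L_def R_def intro!: finite_signed_words intro: finite_subset)
  qed
  also have "\<dots> = (\<Sum>B\<in>\<B>. card (signed_perms_with_peaks T k) * 2 ^ (2 * (n - k) - 1))"
  proof (rule sum.cong[OF refl])
    fix B assume "B \<in> \<B>"
    hence B: "B \<subseteq> N" "card B = k" by (auto simp: \<B>_def)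
    have finB: "finite B" using B finN finite_subset by blast
    have "card (L B) = card (signed_perms_with_peaks T k)"
    proof -
      have "B \<subseteq> {1..}" using B(1) by (auto simp: N_def)
      thus ?thesis using card_signed_words_peaks[OF finB] B(2) by (simp add: L_def)
    qed
    moreover have cNB: "card (N - B) = n - k" using B finB cN by (simp add: card_Diff_subset)
    moreover have "card (R B) = 2 ^ (2 * card (N - B) - 1)"
      unfolding R_def
    proof (rule card_signed_words_no_inner_peak)
      \<comment> \<open>Since \<open>k < n\<close>, the suffix has at least one letter.\<close>
      show "N - B \<noteq> {}" using cNB assms by force
    qed (use finN in \<open>auto simp: N_def\<close>)
    ultimately show "card (L B \<times> R B) = card (signed_perms_with_peaks T k) * 2 ^ (2 * (n - k) - 1)"
      by (simp add: card_cartesian_product)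
  qed
  also have "\<dots> = (n choose k) * card (signed_perms_with_peaks T k) * 2 ^ (2 * (n - k) - 1)"
    using n_subsets[OF finN, of k] cN by (simp add: \<B>_def)
  finally show ?thesis .
qed

section \<open>The recurrence\<close>

lemma peak_set_no_adjacent: "i \<in> peak_set \<pi> \<Longrightarrow> Suc i \<notin> peak_set \<pi>"
  by (auto simp: peak_set_def)

theorem theorem3p2:
  fixes S S1 S2 :: "nat set" and n m :: nat
  assumes "finite S" and "S \<noteq> {}" and "admissible S" and "n_admissible n S"
    and "m = Max S" and "S1 = S - {m}" and "S2 = S1 \<union> {m - 1}"
  shows "int (card (signed_perms_with_peaks S n)) =
           int (n choose (m - 1)) * int (card (signed_perms_with_peaks S1 (m - 1)))
             * 2 ^ (2 * (n - m) + 1)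
           - int (card (signed_perms_with_peaks S1 n))
           - int (card (signed_perms_with_peaks S2 n))"
proof -
  \<comment> \<open>A witness of admissibility shows that \<open>1 \<le> m < n\<close> and that
    \<open>m - 1\<close> is not in \<open>S\<close>.\<close>
  obtain \<rho> where \<rho>: "\<rho> \<in> signed_perms n" "peak_set \<rho> = S"
    using assms(4) by (auto simp: n_admissible_def signed_perms_with_peaks_def)
  have mS: "m \<in> S" using assms(1,2,5) by simp
  have lenr: "length \<rho> = n" using \<rho>(1) by (simp add: signed_perms_def)
  have mn: "1 \<le> m" "m < n" using mS \<rho>(2) lenr by (auto simp: peak_set_def)
  define k where "k = m - 1"
  have mk: "m = Suc k" using mn by (simp add: k_def)
  have kS: "k \<notin> S" using peak_set_no_adjacent[of k \<rho>] mS \<rho>(2) mk by auto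
  have S1: "S1 \<subseteq> {..<k}"
  proof
    fix i assume i: "i \<in> S1"
    hence "i \<le> m" "i \<noteq> m" "i \<noteq> k" using assms(1,5,6) kS by auto
    thus "i \<in> {..<k}" using mk by simp
  qed
  have S: "S = insert (Suc k) S1" using assms(6) mS mk by auto
  \<comment> \<open>For \<open>m = 1\<close> this puts 0 into \<open>S2\<close>; as 0 is never a
    peak, the term for \<open>S2\<close> is then 0.\<close>
  have S2: "S2 = insert k S1" using assms(7) mk by simp
  define X where "X = {\<pi> \<in> signed_perms n. peak_set \<pi> \<inter> {..<k} = S1 \<and> peak_set \<pi> \<inter> {k + 2..} = {}}"
  \<comment> \<open>The two conditions leave only the membership of \<open>k\<close> and
    \<open>Suc k\<close> open; with both excluded at once, three sets remain.\<close>
  have iff: "Q \<inter> {..<k} = S1 \<and> Q \<inter> {k + 2..} = {} \<longleftrightarrow> Q = S \<or> Q = S1 \<or> Q = S2"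
    if "k \<notin> Q \<or> Suc k \<notin> Q" for Q
  proof
    assume a: "Q \<inter> {..<k} = S1 \<and> Q \<inter> {k + 2..} = {}"
    have "Q = (Q \<inter> {..<k}) \<union> (Q \<inter> {k, Suc k}) \<union> (Q \<inter> {k + 2..})" by auto
    hence "Q = S1 \<union> (Q \<inter> {k, Suc k})" using a by simp
    thus "Q = S \<or> Q = S1 \<or> Q = S2" using that S S2 by blast
  next
    assume "Q = S \<or> Q = S1 \<or> Q = S2"
    thus "Q \<inter> {..<k} = S1 \<and> Q \<inter> {k + 2..} = {}" using S1 S S2 by auto
  qed
  have XU: "X = signed_perms_with_peaks S n \<union> (signed_perms_with_peaks S1 n \<union> signed_perms_with_peaks S2 n)"
  proof -
    have "peak_set \<pi> \<inter> {..<k} = S1 \<and> peak_set \<pi> \<inter> {k + 2..} = {} \<longleftrightarrow>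
        peak_set \<pi> = S \<or> peak_set \<pi> = S1 \<or> peak_set \<pi> = S2" for \<pi>
      by (rule iff) (use peak_set_no_adjacent in blast)
    thus ?thesis by (simp add: X_def signed_perms_with_peaks_def conj_disj_distribL Collect_disj_eq)
  qed
  have ne: "S \<noteq> S1" "S \<noteq> S2" "S1 \<noteq> S2" using S S1 S2 by auto
  have fin: "finite (signed_perms_with_peaks T n)" for T
    using finite_signed_perms by (simp add: signed_perms_with_peaks_def)
  have disj: "signed_perms_with_peaks T n \<inter> signed_perms_with_peaks T' n = {}" if "T \<noteq> T'" for T T'
    using that by (auto simp: signed_perms_with_peaks_def)
  have "card X = card (signed_perms_with_peaks S n) +
      (card (signed_perms_with_peaks S1 n) + card (signed_perms_with_peaks S2 n))"
    unfolding XU using fin ne by (simp add: card_Un_disjoint Int_Un_distrib disj)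
  moreover have "card X = (n choose k) * card (signed_perms_with_peaks S1 k) * 2 ^ (2 * (n - k) - 1)"
    unfolding X_def by (rule card_peaks_below_above) (use mn mk in simp)
  \<comment> \<open>Here \<open>n - k = (n - m) + 1\<close>, and \<open>m < n\<close> keeps the
    truncated subtraction exact.\<close>
  moreover have "2 * (n - k) - 1 = 2 * (n - m) + 1" using mn mk by simp
  \<comment> \<open>The count is a sum over the naturals; casting it to integers makes the
    differences in the claim genuine.\<close>
  ultimately have "int ((n choose k) * card (signed_perms_with_peaks S1 k) * 2 ^ (2 * (n - m) + 1)) =
      int (card (signed_perms_with_peaks S n) +
      (card (signed_perms_with_peaks S1 n) + card (signed_perms_with_peaks S2 n)))"
    by simp
  thus ?thesis unfolding k_def by simp
qed

end
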